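(* Let $B_1$ and $B_2$ be finite skew braces, let $I_1\le Z(B_1)$ and $I_2\le Z(B_2)$ be central ideals, and let $\alpha:I_1\to I_2$ be an isomorphism of skew braces. Let $N_\alpha=\{(i,-\alpha(i))\mid i\in I_1\}$ and let $B_1\circ_\alpha B_2=(B_1\times B_2)/N_\alpha$ be the external central product. Put $$\overline B_1=(B_1\times 0+N_\alpha)/N_\alpha,\qquad \overline B_2=(0\times B_2+N_\alpha)/N_\alpha.$$ Then $B_1\circ_\alpha B_2=\overline B_1\circ\overline B_2$, i.e. $B_1\circ_\alpha B_2$ is the internal central product of the ideals $\overline B_1$ and $\overline B_2$, and $$\overline B_1\cap\overline B_2\simeq I_1\simeq I_2$$ as skew braces.
   Context: A skew brace is a triple $(B,+,\cdot)$ such that $(B,+)$ and $(B,\cdot)$ are groups (neither assumed abelian) and $a\cdot(b+c)=a\cdot b-a+a\cdot c$ for all $a,b,c\in B$; both groups have the same identity, denoted $0$. An isomorphism of skew braces is a bijection that is a homomorphism for both operations; the direct product of skew braces has componentwise operations. For $b\in B$ put $\lambda_b(a)=-b+ba$. A subset $I\subseteq B$ is an ideal if $(I,+)\trianglelefteq(B,+)$, $(I,\cdot)\trianglelefteq(B,\cdot)$ and $\lambda_b(I)\subseteq I$ for all $b\in B$; then $a+I=aI$ for all $a\in B$ and $B/I$ is a skew brace. The center $Z(B)$ is the set of $z\in B$ that are central in both $(B,+)$ and $(B,\cdot)$ and satisfy $\lambda_z=\operatorname{id}_B$; it is an ideal. An ideal $I$ of $B$ is central if $I\le Z(B)$. In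 the setting of the claim, $N_\alpha$ is a central ideal of $B_1\times B_2$, so the quotient $B_1\circ_\alpha B_2$ is a skew brace. For $a,b\in B$ let $a*b=-a+ab-b$, and for $X,Y\subseteq B$ let $X*Y$ be the additive subgroup generated by all $x*y$, $x\in X$, $y\in Y$. For ideals $I,J$ of $B$, $B$ is the internal central product of $I$ and $J$, written $B=I\circ J$, if $B=I+J$, $[I,J]_+=0$ (additive commutators of elements of $I$ with elements of $J$ vanish), $I*J=J*I=0$, and $I\cap J\le Z(B)$. *)

theory Defs
  imports "HOL-Algebra.Chinese_Remainder" "HOL-Algebra.Generated_Groups"
begin

text \<open>
  Skew braces are carried by the record type of HOL-Algebra rings, used purely as a signature
  with two operations: \<^term>\<open>add_monoid B\<close> is the additive group \<open>(B, +)\<close> and \<^term>\<open>B\<close> itself,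
  viewed as a monoid record, is the multiplicative group \<open>(B, \<cdot>)\<close>. None of the ring axioms are
  assumed; in particular \<open>\<oplus>\<close> need not be commutative. The direct product
  \<^const>\<open>RDirProd\<close> and the quotient \<^const>\<open>FactRing\<close> (\<open>Quot\<close>) depend only on this signature.
\<close>

locale skew_brace =
  fixes B (structure)
  assumes add_group: "group (add_monoid B)"
    and mult_group: "group B"
    and brace_distrib: "\<lbrakk>a \<in> carrier B; b \<in> carrier B; c \<in> carrier B\<rbrakk>
      \<Longrightarrow> a \<otimes> (b \<oplus> c) = ((a \<otimes> b) \<ominus> a) \<oplus> (a \<otimes> c)"

text \<open>That both groups have the same identity is a consequence of the axioms.\<close>

lemma (in skew_brace) one_eq_zero: "\<one> = \<zero>"
proof -
  interpret A: group "add_monoid B" by (rule add_group)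
  interpret M: group B by (rule mult_group)
  have z: "\<zero> \<in> carrier B" using A.one_closed by simp
  have o: "\<one> \<in> carrier B" by simp
  have "\<ominus> \<one> \<in> carrier B" using A.inv_closed[of \<one>] o by (simp add: a_inv_def)
  moreover have "\<one> \<otimes> (\<zero> \<oplus> \<zero>) = ((\<one> \<otimes> \<zero>) \<ominus> \<one>) \<oplus> (\<one> \<otimes> \<zero>)"
    using brace_distrib o z by blast
  moreover have "\<zero> \<oplus> x = x" "x \<oplus> \<zero> = x" if "x \<in> carrier B" for x
    using A.l_one[of x] A.r_one[of x] that by simp_all
  ultimately have "\<zero> = \<ominus> \<one>" using z by (simp add: a_minus_def)
  then show ?thesis
    using A.inv_eq_1_iff[of \<one>] o by (simp add: a_inv_def)
qed

definition brace_lambda :: "('a, 'm) ring_scheme \<Rightarrow> 'a \<Rightarrow> 'a \<Rightarrow> 'a" where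
  "brace_lambda B b a = (\<ominus>\<^bsub>B\<^esub> b) \<oplus>\<^bsub>B\<^esub> (b \<otimes>\<^bsub>B\<^esub> a)"

definition brace_ideal :: "'a set \<Rightarrow> ('a, 'm) ring_scheme \<Rightarrow> bool" where
  "brace_ideal I B \<longleftrightarrow>
     I \<lhd> add_monoid B \<and> I \<lhd> B \<and> (\<forall>b\<in>carrier B. brace_lambda B b ` I \<subseteq> I)"

definition brace_center :: "('a, 'm) ring_scheme \<Rightarrow> 'a set" where
  "brace_center B = {z \<in> carrier B.
     (\<forall>a\<in>carrier B. z \<oplus>\<^bsub>B\<^esub> a = a \<oplus>\<^bsub>B\<^esub> z) \<and>
     (\<forall>a\<in>carrier B. z \<otimes>\<^bsub>B\<^esub> a = a \<otimes>\<^bsub>B\<^esub> z) \<and>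
     (\<forall>a\<in>carrier B. brace_lambda B z a = a)}"

definition central_ideal :: "'a set \<Rightarrow> ('a, 'm) ring_scheme \<Rightarrow> bool" where
  "central_ideal I B \<longleftrightarrow> brace_ideal I B \<and> I \<subseteq> brace_center B"

definition brace_star :: "('a, 'm) ring_scheme \<Rightarrow> 'a \<Rightarrow> 'a \<Rightarrow> 'a" where
  "brace_star B a b = ((\<ominus>\<^bsub>B\<^esub> a) \<oplus>\<^bsub>B\<^esub> (a \<otimes>\<^bsub>B\<^esub> b)) \<ominus>\<^bsub>B\<^esub> b"

definition brace_star_set :: "('a, 'm) ring_scheme \<Rightarrow> 'a set \<Rightarrow> 'a set \<Rightarrow> 'a set" where
  "brace_star_set B S T = generate (add_monoid B) {brace_star B x y | x y. x \<in> S \<and> y \<in> T}"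

definition brace_iso :: "('a, 'm) ring_scheme \<Rightarrow> ('b, 'n) ring_scheme \<Rightarrow> ('a \<Rightarrow> 'b) set" where
  "brace_iso B C = iso (add_monoid B) (add_monoid C) \<inter> iso B C"

definition brace_isomorphic :: "('a, 'm) ring_scheme \<Rightarrow> ('b, 'n) ring_scheme \<Rightarrow> bool"
    (infix "\<simeq>\<^sub>b" 50) where
  "B \<simeq>\<^sub>b C \<longleftrightarrow> brace_iso B C \<noteq> {}"

text \<open>A subset of a skew brace with the restricted operations; its inherited identities are
  harmless because it is only applied to ideals.\<close>

abbreviation sub_brace :: "('a, 'm) ring_scheme \<Rightarrow> 'a set \<Rightarrow> ('a, 'm) ring_scheme" where
  "sub_brace B I \<equiv> B\<lparr>carrier := I\<rparr>"

definition internal_central_product ::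
    "('a, 'm) ring_scheme \<Rightarrow> 'a set \<Rightarrow> 'a set \<Rightarrow> bool" where
  "internal_central_product B I J \<longleftrightarrow>
     skew_brace B \<and> brace_ideal I B \<and> brace_ideal J B \<and>
     carrier B = I <+>\<^bsub>B\<^esub> J \<and>
     (\<forall>i\<in>I. \<forall>j\<in>J. (((\<ominus>\<^bsub>B\<^esub> i) \<ominus>\<^bsub>B\<^esub> j) \<oplus>\<^bsub>B\<^esub> i) \<oplus>\<^bsub>B\<^esub> j = \<zero>\<^bsub>B\<^esub>) \<and>
     brace_star_set B I J = {\<zero>\<^bsub>B\<^esub>} \<and> brace_star_set B J I = {\<zero>\<^bsub>B\<^esub>} \<and>
     I \<inter> J \<subseteq> brace_center B"

definition amalg :: "('b, 'n) ring_scheme \<Rightarrow> 'a set \<Rightarrow> ('a \<Rightarrow> 'b) \<Rightarrow> ('a \<times> 'b) set" where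
  "amalg B\<^sub>2 I\<^sub>1 \<alpha> = {(i, \<ominus>\<^bsub>B\<^sub>2\<^esub> (\<alpha> i)) | i. i \<in> I\<^sub>1}"

definition external_central_product ::
    "('a, 'm) ring_scheme \<Rightarrow> ('b, 'n) ring_scheme \<Rightarrow> 'a set \<Rightarrow> ('a \<Rightarrow> 'b) \<Rightarrow> ('a \<times> 'b) set ring"
  where "external_central_product B\<^sub>1 B\<^sub>2 I\<^sub>1 \<alpha> = RDirProd B\<^sub>1 B\<^sub>2 Quot amalg B\<^sub>2 I\<^sub>1 \<alpha>"

text \<open>\<open>(S + N)/N\<close> as a subset of \<open>B/N\<close>. The elements of \<open>B Quot N\<close> are the additive right cosets
  \<open>N + x\<close>, which for an ideal \<open>N\<close> coincide with \<open>x + N = xN\<close>.\<close>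

definition image_mod :: "('a, 'm) ring_scheme \<Rightarrow> 'a set \<Rightarrow> 'a set \<Rightarrow> 'a set set" where
  "image_mod B N S = (\<lambda>x. N +>\<^bsub>B\<^esub> x) ` (S <+>\<^bsub>B\<^esub> N)"

definition left_factor ::
    "('a, 'm) ring_scheme \<Rightarrow> ('b, 'n) ring_scheme \<Rightarrow> 'a set \<Rightarrow> ('a \<Rightarrow> 'b) \<Rightarrow> ('a \<times> 'b) set set"
  where "left_factor B\<^sub>1 B\<^sub>2 I\<^sub>1 \<alpha> =
    image_mod (RDirProd B\<^sub>1 B\<^sub>2) (amalg B\<^sub>2 I\<^sub>1 \<alpha>) (carrier B\<^sub>1 \<times> {\<zero>\<^bsub>B\<^sub>2\<^esub>})"

definition right_factor ::
    "('a, 'm) ring_scheme \<Rightarrow> ('b, 'n) ring_scheme \<Rightarrow> 'a set \<Rightarrow> ('a \<Rightarrow> 'b) \<Rightarrow> ('a \<times> 'b) set set"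
  where "right_factor B\<^sub>1 B\<^sub>2 I\<^sub>1 \<alpha> =
    image_mod (RDirProd B\<^sub>1 B\<^sub>2) (amalg B\<^sub>2 I\<^sub>1 \<alpha>) ({\<zero>\<^bsub>B\<^sub>1\<^esub>} \<times> carrier B\<^sub>2)"

end

theory Submission
  imports Defs
begin

text \<open>
  Everything is transported along the quotient map \<open>\<pi>\<close> of \<open>B\<^sub>1 \<times> B\<^sub>2\<close> by the central ideal
  \<open>N = {(i, - \<alpha> i)}\<close>: the two factors are the images of the ideals \<open>B\<^sub>1 \<times> 0\<close> and \<open>0 \<times> B\<^sub>2\<close>, which
  commute and have trivial star products already in \<open>B\<^sub>1 \<times> B\<^sub>2\<close>. Moreover \<open>\<pi> (a, 0) = \<pi> (0, b)\<close> means
  \<open>(a, - b) \<in> N\<close>, i.e. \<open>a \<in> I\<^sub>1\<close> and \<open>b = \<alpha> a\<close>, so the factors meet in the central set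
  \<open>\<pi> (I\<^sub>1 \<times> 0)\<close>, on which \<open>\<pi>\<close> is injective because \<open>\<alpha>\<close> is.
\<close>

section \<open>Centers and central ideals of a skew brace\<close>

context skew_brace
begin

text \<open>The rewrites turn facts about the group \<open>add_monoid B\<close> into ring notation,
  so that group theory applies directly to expressions in \<open>\<oplus>\<close> and
  \<open>\<ominus>\<close>.\<close>

sublocale add: group "add_monoid B"
  rewrites "carrier (add_monoid B) = carrier B"
    and "mult (add_monoid B) = add B"
    and "one (add_monoid B) = zero B"
    and "m_inv (add_monoid B) = a_inv B"
    and "r_coset (add_monoid B) = a_r_coset B"
    and "set_mult (add_monoid B) = set_add B"
  by (rule add_group) (auto simp: a_inv_def a_r_coset_def set_add_def)

sublocale mult: group B
  by (rule mult_group)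

text \<open>The condition \<lambda>_z(a) = -z + za = a is solved for za, the form in which later
  computations use it.\<close>

lemma brace_centerD:
  assumes "z \<in> brace_center B"
  shows "z \<in> carrier B"
    and "a \<in> carrier B \<Longrightarrow> z \<oplus> a = a \<oplus> z"
    and "a \<in> carrier B \<Longrightarrow> z \<otimes> a = a \<otimes> z"
    and "a \<in> carrier B \<Longrightarrow> z \<otimes> a = z \<oplus> a"
proof -
  show z: "z \<in> carrier B" and "a \<in> carrier B \<Longrightarrow> z \<oplus> a = a \<oplus> z"
    and "a \<in> carrier B \<Longrightarrow> z \<otimes> a = a \<otimes> z"
    using assms by (auto simp: brace_center_def)
  assume a: "a \<in> carrier B"
  have "\<ominus> z \<oplus> (z \<otimes> a) = a"
    using assms a unfolding brace_center_def brace_lambda_def by blast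
  then show "z \<otimes> a = z \<oplus> a"
    using z a by (metis add.inv_solve_left mult.m_closed)
qed

lemma brace_centerI:
  assumes "z \<in> carrier B"
    and "\<And>a. a \<in> carrier B \<Longrightarrow> z \<oplus> a = a \<oplus> z"
    and "\<And>a. a \<in> carrier B \<Longrightarrow> z \<otimes> a = a \<otimes> z"
    and "\<And>a. a \<in> carrier B \<Longrightarrow> z \<otimes> a = z \<oplus> a"
  shows "z \<in> brace_center B"
proof -
  have "brace_lambda B z a = a" if "a \<in> carrier B" for a
    using assms(1,4) that by (simp add: brace_lambda_def add.m_assoc[symmetric])
  then show ?thesis
    using assms(1-3) by (auto simp: brace_center_def)
qed

lemma zero_mult [simp]: "a \<in> carrier B \<Longrightarrow> \<zero> \<otimes> a = a" "a \<in> carrier B \<Longrightarrow> a \<otimes> \<zero> = a"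
  by (simp_all flip: one_eq_zero)

lemma inv_zero [simp]: "inv \<zero> = \<zero>"
  using mult.inv_one by (simp only: one_eq_zero)

text \<open>Centrality gives az = za = z + a = a + z. Hence subsets of the center are invariant
  under every \<lambda>_a.\<close>

lemma brace_lambda_central:
  assumes "z \<in> brace_center B" "a \<in> carrier B"
  shows "brace_lambda B a z = z"
proof -
  have "brace_lambda B a z = \<ominus> a \<oplus> (a \<oplus> z)"
    using brace_centerD(2,3,4)[OF assms(1,2)] by (simp add: brace_lambda_def)
  then show ?thesis
    using assms brace_centerD(1)[OF assms(1)] by (simp add: add.m_assoc[symmetric])
qed

text \<open>Multiplication by a central element coincides with addition, so an additive subgroup of the
  center is automatically a multiplicative one.\<close>

lemma central_ideal_iff_subgroup:
  "central_ideal N B \<longleftrightarrow> subgroup N (add_monoid B) \<and> N \<subseteq> brace_center B"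
proof
  assume "central_ideal N B"
  then show "subgroup N (add_monoid B) \<and> N \<subseteq> brace_center B"
    by (simp add: central_ideal_def brace_ideal_def normal_imp_subgroup)
next
  assume asm: "subgroup N (add_monoid B) \<and> N \<subseteq> brace_center B"
  then have sub: "subgroup N (add_monoid B)" and cen: "\<And>n. n \<in> N \<Longrightarrow> n \<in> brace_center B" by auto
  have car: "n \<in> carrier B" if "n \<in> N" for n
    using brace_centerD(1)[OF cen[OF that]] .
  have "N \<lhd> add_monoid B"
    unfolding add.normal_inv_iff
  proof (intro conjI ballI)
    fix x n assume xn: "x \<in> carrier B" "n \<in> N"
    have "x \<oplus> n \<oplus> \<ominus> x = n \<oplus> (x \<oplus> \<ominus> x)"
      using brace_centerD(2)[OF cen[OF xn(2)] xn(1)] xn car[OF xn(2)]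
      by (metis add.inv_closed add.m_assoc)
    then show "x \<oplus> n \<oplus> \<ominus> x \<in> N"
      using xn car by simp
  qed (rule sub)
  moreover have "N \<lhd> B"
    unfolding mult.normal_inv_iff
  proof (intro conjI ballI)
    \<comment> \<open>Multiplying by the central n is adding n, so n times -n is n + (-n) = 0, which
      is also the multiplicative identity.\<close>
    have inv: "inv n = \<ominus> n" if n: "n \<in> N" for n
    proof (rule mult.inv_equality)
      have "n \<otimes> \<ominus> n = \<one>"
        using brace_centerD(4)[OF cen[OF n], of "\<ominus> n"] car[OF n] by (simp add: one_eq_zero)
      then show "\<ominus> n \<otimes> n = \<one>"
        using brace_centerD(3)[OF cen[OF n], of "\<ominus> n"] car[OF n] by simp
    qed (use n car in auto)
    show "subgroup N B"
    proof
      show "N \<subseteq> carrier B" using car by auto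
      show "\<one> \<in> N" using subgroup.one_closed[OF sub] by (simp add: one_eq_zero)
      show "x \<otimes> y \<in> N" if "x \<in> N" "y \<in> N" for x y
        using subgroup.m_closed[OF sub that] brace_centerD(4)[OF cen[OF that(1)] car[OF that(2)]]
        by simp
      show "inv x \<in> N" if "x \<in> N" for x
        using add.subgroupE(3)[OF sub that] inv[OF that] by simp
    qed
    fix x n assume xn: "x \<in> carrier B" "n \<in> N"
    have "x \<otimes> n \<otimes> inv x = n \<otimes> (x \<otimes> inv x)"
      using brace_centerD(3)[OF cen[OF xn(2)] xn(1)] xn car[OF xn(2)]
      by (metis mult.inv_closed mult.m_assoc)
    then show "x \<otimes> n \<otimes> inv x \<in> N"
      using xn car by simp
  qed
  moreover have "\<forall>b\<in>carrier B. brace_lambda B b ` N \<subseteq> N"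
    using brace_lambda_central cen by auto
  ultimately show "central_ideal N B"
    using asm by (simp add: central_ideal_def brace_ideal_def)
qed

end

section \<open>Surjective homomorphisms of skew braces\<close>

locale skew_brace_epi = skew_brace B for B (structure) +
  fixes C :: "('c, 'k) ring_scheme" and h
  assumes hom_add: "h \<in> hom (add_monoid B) (add_monoid C)"
    and hom_mult: "h \<in> hom B C"
    and h_zero: "h \<zero> = \<zero>\<^bsub>C\<^esub>"
    and h_one: "h \<one> = \<one>\<^bsub>C\<^esub>"
    and surj: "h ` carrier B = carrier C"
begin

text \<open>The image of a group is a group whose identity is the image of the identity;
  \<open>h_zero\<close> and \<open>h_one\<close> match it with the one recorded in C. The brace law
  is lifted to B by surjectivity.\<close>

lemma image_is_skew_brace: "skew_brace C"
proof (rule skew_brace.intro)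
  have "group ((add_monoid C)\<lparr>carrier := h ` carrier B, one := h \<zero>\<rparr>)"
    using add.hom_imp_img_group[OF hom_add] by simp
  then show add: "group (add_monoid C)"
    by (simp add: surj h_zero)
  have "group (C\<lparr>carrier := h ` carrier B, one := h \<one>\<rparr>)"
    using mult.hom_imp_img_group[OF hom_mult] by simp
  then show "group C"
    by (simp add: surj h_one)
  fix a b c assume "a \<in> carrier C" "b \<in> carrier C" "c \<in> carrier C"
  then obtain x y z where x: "x \<in> carrier B" "a = h x" and y: "y \<in> carrier B" "b = h y"
    and z: "z \<in> carrier B" "c = h z"
    by (auto simp flip: surj)
  have add_h: "h (u \<oplus> v) = h u \<oplus>\<^bsub>C\<^esub> h v" if "u \<in> carrier B" "v \<in> carrier B" for u v
    using hom_add that by (simp add: hom_def)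
  have mult_h: "h (u \<otimes> v) = h u \<otimes>\<^bsub>C\<^esub> h v" if "u \<in> carrier B" "v \<in> carrier B" for u v
    using hom_mult that by (simp add: hom_def)
  \<comment> \<open>The brace law contains a minus sign, so h must also respect additive
    inverses.\<close>
  have "group_hom (add_monoid B) (add_monoid C) h"
    using add_group add hom_add by (simp add: group_hom_def group_hom_axioms_def)
  then have "h (\<ominus> x) = \<ominus>\<^bsub>C\<^esub> h x"
    using group_hom.hom_inv[of "add_monoid B" "add_monoid C" h x] x by (simp add: a_inv_def)
  then show "a \<otimes>\<^bsub>C\<^esub> (b \<oplus>\<^bsub>C\<^esub> c) = ((a \<otimes>\<^bsub>C\<^esub> b) \<ominus>\<^bsub>C\<^esub> a) \<oplus>\<^bsub>C\<^esub> (a \<otimes>\<^bsub>C\<^esub> c)"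
    using x y z arg_cong[OF brace_distrib[of x y z], of h]
    by (simp add: a_minus_def add_h mult_h)
qed

sublocale C: skew_brace C
  by (rule image_is_skew_brace)

lemma h_closed [simp]: "x \<in> carrier B \<Longrightarrow> h x \<in> carrier C"
  using surj by auto

lemma h_add: "\<lbrakk>x \<in> carrier B; y \<in> carrier B\<rbrakk> \<Longrightarrow> h (x \<oplus> y) = h x \<oplus>\<^bsub>C\<^esub> h y"
  using hom_add by (simp add: hom_def)

lemma h_mult: "\<lbrakk>x \<in> carrier B; y \<in> carrier B\<rbrakk> \<Longrightarrow> h (x \<otimes> y) = h x \<otimes>\<^bsub>C\<^esub> h y"
  using hom_mult by (simp add: hom_def)

sublocale add_hom: group_hom "add_monoid B" "add_monoid C" h
  using add_group C.add_group hom_add by (simp add: group_hom_def group_hom_axioms_def)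

sublocale mult_hom: group_hom B C h
  using mult_group C.mult_group hom_mult by (simp add: group_hom_def group_hom_axioms_def)

lemma h_a_inv: "x \<in> carrier B \<Longrightarrow> h (\<ominus> x) = \<ominus>\<^bsub>C\<^esub> h x"
  using add_hom.hom_inv[of x] by (simp add: a_inv_def)

lemma h_lambda:
  "\<lbrakk>x \<in> carrier B; y \<in> carrier B\<rbrakk> \<Longrightarrow> h (brace_lambda B x y) = brace_lambda C (h x) (h y)"
  by (simp add: brace_lambda_def h_add h_mult h_a_inv)

text \<open>With \<open>h_commutator\<close> below, this carries the relations defining a central
  product from B to C.\<close>

lemma h_star:
  "\<lbrakk>x \<in> carrier B; y \<in> carrier B\<rbrakk> \<Longrightarrow> h (brace_star B x y) = brace_star C (h x) (h y)"
  by (simp add: brace_star_def a_minus_def h_add h_mult h_a_inv)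

lemma h_commutator:
  "\<lbrakk>x \<in> carrier B; y \<in> carrier B\<rbrakk> \<Longrightarrow>
    h (\<ominus> x \<ominus> y \<oplus> x \<oplus> y) = \<ominus>\<^bsub>C\<^esub> h x \<ominus>\<^bsub>C\<^esub> h y \<oplus>\<^bsub>C\<^esub> h x \<oplus>\<^bsub>C\<^esub> h y"
  by (simp add: a_minus_def h_add h_a_inv)

text \<open>By surjectivity every element tested against h z is itself some h x, so the identities
  between z and x can be pushed through h.\<close>

lemma image_center: "h ` brace_center B \<subseteq> brace_center C"
proof
  fix c assume "c \<in> h ` brace_center B"
  then obtain z where z: "z \<in> brace_center B" "c = h z" by auto
  note zD = brace_centerD[OF z(1)]
  show "c \<in> brace_center C"
  proof (rule C.brace_centerI)
    show "c \<in> carrier C" using zD(1) z by simp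
    fix a assume "a \<in> carrier C"
    then obtain x where x: "x \<in> carrier B" "a = h x" by (auto simp flip: surj)
    show "c \<oplus>\<^bsub>C\<^esub> a = a \<oplus>\<^bsub>C\<^esub> c" "c \<otimes>\<^bsub>C\<^esub> a = a \<otimes>\<^bsub>C\<^esub> c" "c \<otimes>\<^bsub>C\<^esub> a = c \<oplus>\<^bsub>C\<^esub> a"
      using zD x z(2) by (simp_all flip: h_add h_mult)
  qed
qed

text \<open>Conjugating elements of C, and indices of \<lambda>, lift to B by surjectivity; closure
  of I there maps to closure of the image.\<close>

lemma image_ideal:
  assumes "brace_ideal I B"
  shows "brace_ideal (h ` I) C"
proof -
  have I: "I \<lhd> add_monoid B" "I \<lhd> B" "\<And>b. b \<in> carrier B \<Longrightarrow> brace_lambda B b ` I \<subseteq> I"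
    using assms by (auto simp: brace_ideal_def)
  have sub: "I \<subseteq> carrier B"
    using I(2) by (meson normal_imp_subgroup subgroup.subset)
  have "h ` I \<lhd> add_monoid C"
    unfolding C.add.normal_inv_iff
  proof (intro conjI ballI)
    show "subgroup (h ` I) (add_monoid C)"
      using add_hom.subgroup_img_is_subgroup[OF normal_imp_subgroup[OF I(1)]] .
    fix c k assume "c \<in> carrier C" "k \<in> h ` I"
    then obtain x i where x: "x \<in> carrier B" "c = h x" and i: "i \<in> I" "k = h i"
      by (auto simp flip: surj)
    have "x \<oplus> i \<oplus> \<ominus> x \<in> I"
      using I(1) x i unfolding add.normal_inv_iff by blast
    moreover have "c \<oplus>\<^bsub>C\<^esub> k \<oplus>\<^bsub>C\<^esub> \<ominus>\<^bsub>C\<^esub> c = h (x \<oplus> i \<oplus> \<ominus> x)"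
      using x i sub by (simp add: h_add h_a_inv subset_iff)
    ultimately show "c \<oplus>\<^bsub>C\<^esub> k \<oplus>\<^bsub>C\<^esub> \<ominus>\<^bsub>C\<^esub> c \<in> h ` I" by simp
  qed
  moreover have "h ` I \<lhd> C"
    unfolding C.mult.normal_inv_iff
  proof (intro conjI ballI)
    show "subgroup (h ` I) C"
      using mult_hom.subgroup_img_is_subgroup[OF normal_imp_subgroup[OF I(2)]] .
    fix c k assume "c \<in> carrier C" "k \<in> h ` I"
    then obtain x i where x: "x \<in> carrier B" "c = h x" and i: "i \<in> I" "k = h i"
      by (auto simp flip: surj)
    have "x \<otimes> i \<otimes> inv x \<in> I"
      using I(2) x i unfolding mult.normal_inv_iff by blast
    moreover have "c \<otimes>\<^bsub>C\<^esub> k \<otimes>\<^bsub>C\<^esub> inv\<^bsub>C\<^esub> c = h (x \<otimes> i \<otimes> inv x)"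
      using x i sub by (simp add: h_mult subset_iff)
    ultimately show "c \<otimes>\<^bsub>C\<^esub> k \<otimes>\<^bsub>C\<^esub> inv\<^bsub>C\<^esub> c \<in> h ` I" by simp
  qed
  moreover have "brace_lambda C c ` h ` I \<subseteq> h ` I" if c: "c \<in> carrier C" for c
  proof -
    obtain x where "x \<in> carrier B" "c = h x" using c by (auto simp flip: surj)
    then show ?thesis
      using I(3)[of x] sub by (auto simp: subset_iff simp flip: h_lambda)
  qed
  ultimately show ?thesis
    by (simp add: brace_ideal_def)
qed

end

section \<open>The quotient by a central ideal\<close>

text \<open>The product of two cosets in \<open>Quot\<close> is the union of the cosets of all uv
  with u, v running through them. Changing representatives by n, m in N changes uv by n + m in N, so
  all these cosets coincide.\<close>

lemma (in skew_brace) rcos_mult_central: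
  assumes "central_ideal N B" "x \<in> carrier B" "y \<in> carrier B"
  shows "rcoset_mult B N (N +> x) (N +> y) = N +> (x \<otimes> y)"
proof -
  have sub: "subgroup N (add_monoid B)" and cen: "\<And>n. n \<in> N \<Longrightarrow> n \<in> brace_center B"
    using assms(1) by (auto simp: central_ideal_iff_subgroup)
  have "N +> (u \<otimes> v) = N +> (x \<otimes> y)" if uv: "u \<in> N +> x" "v \<in> N +> y" for u v
  proof -
    obtain n m where n: "n \<in> N" "u = n \<oplus> x" and m: "m \<in> N" "v = m \<oplus> y"
      using uv by (auto simp: a_r_coset_def')
    note nD = brace_centerD[OF cen[OF n(1)]] and mD = brace_centerD[OF cen[OF m(1)]]
    \<comment> \<open>Sums with n and m become products, centrality moves m past x, and the products
      with n and m become sums again.\<close>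
    have "u \<otimes> v = (n \<otimes> x) \<otimes> (m \<otimes> y)"
      using n m nD(4) mD(4) assms by simp
    also have "\<dots> = n \<otimes> (m \<otimes> (x \<otimes> y))"
      using nD(1) mD(1) mD(3)[OF assms(2)] assms by (metis mult.m_assoc mult.m_closed)
    also have "\<dots> = (n \<oplus> m) \<oplus> (x \<otimes> y)"
      using nD(1,4) mD(1,4) assms by (simp add: add.m_assoc)
    finally have "u \<otimes> v \<in> N +> (x \<otimes> y)"
      using subgroup.m_closed[OF sub n(1) m(1)] by (auto simp: a_r_coset_def')
    then show ?thesis
      using add.repr_independence[OF _ _ sub] assms by simp
  qed
  \<comment> \<open>Both cosets are nonempty, so the union is that common coset and not the empty
    set.\<close>
  moreover have "x \<in> N +> x" "y \<in> N +> y"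
    using add.rcos_self[OF _ sub] assms by auto
  ultimately show ?thesis
    unfolding rcoset_mult_def by blast
qed

text \<open>The additive half rests on normality of N, the multiplicative half on
  \<open>rcos_mult_central\<close>. As an image of B, the quotient then is a skew brace.\<close>

lemma (in skew_brace) quotient_epi:
  assumes "central_ideal N B"
  shows "skew_brace_epi B (B Quot N) ((+>) N)"
proof unfold_locales
  have nor: "N \<lhd> add_monoid B"
    using assms by (simp add: central_ideal_def brace_ideal_def)
  then have sub: "subgroup N (add_monoid B)"
    by (rule normal_imp_subgroup)
  show surj: "(+>) N ` carrier B = carrier (B Quot N)"
    by (auto simp: FactRing_def A_RCOSETS_def')
  show "(+>) N \<in> hom (add_monoid B) (add_monoid (B Quot N))"
    using surj normal.rcos_sum[OF nor]
    by (auto simp: hom_def FactRing_def a_r_coset_def set_add_def)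
  show "(+>) N \<in> hom B (B Quot N)"
    using surj rcos_mult_central[OF assms]
    by (auto simp: hom_def FactRing_def)
  \<comment> \<open>The zero of \<open>B Quot N\<close> is the set N itself, whereas its one is by
    definition the coset of \<open>\<one>\<close>.\<close>
  show "N +> \<zero> = \<zero>\<^bsub>B Quot N\<^esub>"
    using add.coset_join2[OF _ sub] subgroup.one_closed[OF sub] by (simp add: FactRing_def)
  show "N +> \<one> = \<one>\<^bsub>B Quot N\<^esub>"
    by (simp add: FactRing_def)
qed

section \<open>Direct products of skew braces\<close>

lemma RDirProd_simps [simp]:
  "carrier (RDirProd R S) = carrier R \<times> carrier S"
  "(a, b) \<otimes>\<^bsub>RDirProd R S\<^esub> (c, d) = (a \<otimes>\<^bsub>R\<^esub> c, b \<otimes>\<^bsub>S\<^esub> d)"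
  "(a, b) \<oplus>\<^bsub>RDirProd R S\<^esub> (c, d) = (a \<oplus>\<^bsub>R\<^esub> c, b \<oplus>\<^bsub>S\<^esub> d)"
  "\<zero>\<^bsub>RDirProd R S\<^esub> = (\<zero>\<^bsub>R\<^esub>, \<zero>\<^bsub>S\<^esub>)"
  "\<one>\<^bsub>RDirProd R S\<^esub> = (\<one>\<^bsub>R\<^esub>, \<one>\<^bsub>S\<^esub>)"
  by (auto simp: RDirProd_def DirProd_def monoid.defs)

text \<open>As a simplification rule this would rewrite the additive group of the product into a
  \<open>DirProd\<close>, and facts about \<open>add_monoid D\<close> would no longer match.\<close>

declare RDirProd_add_monoid [simp del]

locale skew_brace_pair = B1: skew_brace B\<^sub>1 + B2: skew_brace B\<^sub>2
  for B\<^sub>1 :: "('a, 'm) ring_scheme" and B\<^sub>2 :: "('b, 'n) ring_scheme"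
begin

abbreviation D :: "('a \<times> 'b) ring" where "D \<equiv> RDirProd B\<^sub>1 B\<^sub>2"

lemma RDirProd_a_inv [simp]:
  assumes "a \<in> carrier B\<^sub>1" "b \<in> carrier B\<^sub>2"
  shows "\<ominus>\<^bsub>D\<^esub> (a, b) = (\<ominus>\<^bsub>B\<^sub>1\<^esub> a, \<ominus>\<^bsub>B\<^sub>2\<^esub> b)"
  using inv_DirProd[OF B1.add_group B2.add_group, of a b] assms
  unfolding a_inv_def RDirProd_add_monoid by simp

sublocale D: skew_brace D
proof (rule skew_brace.intro)
  show "group (add_monoid D)"
    using DirProd_group[OF B1.add_group B2.add_group] unfolding RDirProd_add_monoid .
  \<comment> \<open>\<open>D\<close> extends this record by an addition and a zero; the types
    differ, so the group axioms are unfolded to transfer them.\<close>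
  have "group (B\<^sub>1 \<times>\<times> B\<^sub>2)"
    using DirProd_group[OF B1.mult_group B2.mult_group] .
  then show "group D"
    unfolding group_def group_axioms_def monoid_def Units_def
    by (auto simp: DirProd_def RDirProd_def monoid.defs)
  show "a \<otimes>\<^bsub>D\<^esub> (b \<oplus>\<^bsub>D\<^esub> c) = ((a \<otimes>\<^bsub>D\<^esub> b) \<ominus>\<^bsub>D\<^esub> a) \<oplus>\<^bsub>D\<^esub> (a \<otimes>\<^bsub>D\<^esub> c)"
    if "a \<in> carrier D" "b \<in> carrier D" "c \<in> carrier D" for a b c
    using that B1.brace_distrib B2.brace_distrib by (auto simp: a_minus_def)
qed

lemma RDirProd_inv [simp]:
  assumes "a \<in> carrier B\<^sub>1" "b \<in> carrier B\<^sub>2"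
  shows "inv\<^bsub>D\<^esub> (a, b) = (inv\<^bsub>B\<^sub>1\<^esub> a, inv\<^bsub>B\<^sub>2\<^esub> b)"
  by (rule D.mult.inv_equality) (use assms in auto)

text \<open>The center conditions are checked in each coordinate. This later makes both
  \<open>N\<close> and I_1 x 0 central in \<open>D\<close>.\<close>

lemma brace_center_RDirProd: "brace_center B\<^sub>1 \<times> brace_center B\<^sub>2 \<subseteq> brace_center D"
  by (auto intro!: D.brace_centerI
    intro: B1.brace_centerD B2.brace_centerD B1.brace_centerD(2)[symmetric])

text \<open>As 0 is the identity of both groups, a zero coordinate survives both conjugations and
  every \<lambda>.\<close>

lemma left_ideal: "brace_ideal (carrier B\<^sub>1 \<times> {\<zero>\<^bsub>B\<^sub>2\<^esub>}) D"
proof -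
  have "subgroup (carrier B\<^sub>1 \<times> {\<zero>\<^bsub>B\<^sub>2\<^esub>}) (add_monoid D)"
    by (rule D.add.subgroupI) auto
  moreover have "subgroup (carrier B\<^sub>1 \<times> {\<zero>\<^bsub>B\<^sub>2\<^esub>}) D"
    by (rule D.mult.subgroupI) auto
  ultimately show ?thesis
    unfolding brace_ideal_def D.add.normal_inv_iff D.mult.normal_inv_iff
    by (auto simp: brace_lambda_def B2.one_eq_zero)
qed

lemma right_ideal: "brace_ideal ({\<zero>\<^bsub>B\<^sub>1\<^esub>} \<times> carrier B\<^sub>2) D"
proof -
  have "subgroup ({\<zero>\<^bsub>B\<^sub>1\<^esub>} \<times> carrier B\<^sub>2) (add_monoid D)"
    by (rule D.add.subgroupI) auto
  moreover have "subgroup ({\<zero>\<^bsub>B\<^sub>1\<^esub>} \<times> carrier B\<^sub>2) D"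
    by (rule D.mult.subgroupI) auto
  ultimately show ?thesis
    unfolding brace_ideal_def D.add.normal_inv_iff D.mult.normal_inv_iff
    by (auto simp: brace_lambda_def B1.one_eq_zero)
qed

end

section \<open>Cosets, trivial star products and isomorphisms\<close>

lemma (in skew_brace) rcos_eq_iff:
  assumes "subgroup N (add_monoid B)" "x \<in> carrier B" "y \<in> carrier B"
  shows "N +> x = N +> y \<longleftrightarrow> x \<oplus> \<ominus> y \<in> N"
proof -
  have "x \<in> N +> y \<longleftrightarrow> x \<oplus> \<ominus> y \<in> N"
    using subgroup.rcos_module[OF assms(1) add_group, of y x] assms
    by (simp add: a_r_coset_def a_inv_def)
  then show ?thesis
    using add.repr_independence[OF _ assms(3,1)] add.rcos_self[OF assms(2,1)] by metis
qed

lemma zero_FactRing: "\<zero>\<^bsub>R Quot I\<^esub> = I"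
  by (simp add: FactRing_def)

text \<open>The projection sends N to zero, so s + n and s have the same class. The factors (S +
  N)/N thus become plain images of ideals.\<close>

lemma (in skew_brace) image_mod_central:
  assumes "central_ideal N B" "S \<subseteq> carrier B"
  shows "image_mod B N S = (\<lambda>x. N +> x) ` S"
proof -
  interpret \<pi>: skew_brace_epi B "B Quot N" "(+>) N"
    by (rule quotient_epi[OF assms(1)])
  have sub: "subgroup N (add_monoid B)"
    using assms(1) by (simp add: central_ideal_iff_subgroup)
  have N: "n \<in> carrier B" "N +> n = \<zero>\<^bsub>B Quot N\<^esub>" if "n \<in> N" for n
    using add.coset_join2[OF _ sub that] subgroup.mem_carrier[OF sub that]
    by (simp_all add: zero_FactRing)
  have *: "N +> (s \<oplus> n) = N +> s" if "s \<in> S" "n \<in> N" for s n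
  proof -
    have s: "s \<in> carrier B"
      using assms(2) that by auto
    have "N +> (s \<oplus> n) = (N +> s) \<oplus>\<^bsub>B Quot N\<^esub> \<zero>\<^bsub>B Quot N\<^esub>"
      unfolding N(2)[OF that(2), symmetric] by (rule \<pi>.h_add[OF s N(1)[OF that(2)]])
    also have "\<dots> = N +> s"
      by (rule \<pi>.C.add.r_one[OF \<pi>.h_closed[OF s]])
    finally show ?thesis .
  qed
  \<comment> \<open>This gives S \<subseteq> S + N, hence the remaining inclusion.\<close>
  moreover have "\<zero> \<in> N"
    using subgroup.one_closed[OF sub] by simp
  ultimately show ?thesis
    unfolding image_mod_def set_add_def' by (force simp: image_iff)
qed

lemma (in group) generate_trivial: "S \<subseteq> {\<one>} \<Longrightarrow> generate G S = {\<one>}"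
proof (intro equalityI subsetI)
  fix x assume "x \<in> generate G S" "S \<subseteq> {\<one>}"
  then show "x \<in> {\<one>}" by (induct rule: generate.induct) auto
qed (auto intro: generate.one)

text \<open>Reduces a condition on a generated subgroup to its generators, which can be handled
  element by element.\<close>

lemma (in skew_brace) brace_star_set_trivial:
  assumes "\<And>x y. \<lbrakk>x \<in> S; y \<in> T\<rbrakk> \<Longrightarrow> brace_star B x y = \<zero>"
  shows "brace_star_set B S T = {\<zero>}"
  unfolding brace_star_set_def by (rule add.generate_trivial) (use assms in auto)

lemma brace_isoI:
  assumes "bij_betw f (carrier B) (carrier C)"
    and "\<And>x y. \<lbrakk>x \<in> carrier B; y \<in> carrier B\<rbrakk> \<Longrightarrow> f (x \<oplus>\<^bsub>B\<^esub> y) = f x \<oplus>\<^bsub>C\<^esub> f y"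
    and "\<And>x y. \<lbrakk>x \<in> carrier B; y \<in> carrier B\<rbrakk> \<Longrightarrow> f (x \<otimes>\<^bsub>B\<^esub> y) = f x \<otimes>\<^bsub>C\<^esub> f y"
  shows "f \<in> brace_iso B C"
  using assms bij_betwE[OF assms(1)] by (auto simp: brace_iso_def iso_def hom_def)

text \<open>One map f is an isomorphism for both operations, so the single function
  \<open>inv_into (carrier B) f\<close> inverts both.\<close>

lemma brace_isomorphic_sym:
  assumes "group (add_monoid B)" "group B" "B \<simeq>\<^sub>b C"
  shows "C \<simeq>\<^sub>b B"
proof -
  obtain f where "f \<in> iso (add_monoid B) (add_monoid C)" "f \<in> iso B C"
    using assms(3) by (auto simp: brace_isomorphic_def brace_iso_def)
  then have "inv_into (carrier B) f \<in> brace_iso C B"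
    using group.iso_set_sym[OF assms(1)] group.iso_set_sym[OF assms(2)]
    by (fastforce simp: brace_iso_def)
  then show ?thesis by (auto simp: brace_isomorphic_def)
qed

section \<open>The amalgamating ideal and the quotient map\<close>

locale central_amalgam = skew_brace_pair B\<^sub>1 B\<^sub>2
  for B\<^sub>1 :: "('a, 'm) ring_scheme" and B\<^sub>2 :: "('b, 'n) ring_scheme" +
  fixes I\<^sub>1 :: "'a set" and I\<^sub>2 :: "'b set" and \<alpha> :: "'a \<Rightarrow> 'b"
  assumes central1: "central_ideal I\<^sub>1 B\<^sub>1"
    and central2: "central_ideal I\<^sub>2 B\<^sub>2"
    and iso: "\<alpha> \<in> brace_iso (sub_brace B\<^sub>1 I\<^sub>1) (sub_brace B\<^sub>2 I\<^sub>2)"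
begin

abbreviation N :: "('a \<times> 'b) set" where "N \<equiv> amalg B\<^sub>2 I\<^sub>1 \<alpha>"
abbreviation P :: "('a \<times> 'b) set ring" where "P \<equiv> external_central_product B\<^sub>1 B\<^sub>2 I\<^sub>1 \<alpha>"
abbreviation \<pi> :: "'a \<times> 'b \<Rightarrow> ('a \<times> 'b) set" where "\<pi> \<equiv> (+>\<^bsub>D\<^esub>) N"

lemma sub1: "subgroup I\<^sub>1 (add_monoid B\<^sub>1)" and center1: "I\<^sub>1 \<subseteq> brace_center B\<^sub>1"
  using central1 by (auto simp: B1.central_ideal_iff_subgroup)

lemma sub2: "subgroup I\<^sub>2 (add_monoid B\<^sub>2)" and center2: "I\<^sub>2 \<subseteq> brace_center B\<^sub>2"
  using central2 by (auto simp: B2.central_ideal_iff_subgroup)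

lemma carrier1: "i \<in> I\<^sub>1 \<Longrightarrow> i \<in> carrier B\<^sub>1"
  using center1 B1.brace_centerD(1) by auto

lemma carrier2: "i \<in> I\<^sub>2 \<Longrightarrow> i \<in> carrier B\<^sub>2"
  using center2 B2.brace_centerD(1) by auto

lemma bij: "bij_betw \<alpha> I\<^sub>1 I\<^sub>2"
  using iso by (simp add: brace_iso_def iso_def)

lemma \<alpha>_closed: "i \<in> I\<^sub>1 \<Longrightarrow> \<alpha> i \<in> I\<^sub>2"
  using bij by (rule bij_betwE[rule_format])

lemma \<alpha>_carrier: "i \<in> I\<^sub>1 \<Longrightarrow> \<alpha> i \<in> carrier B\<^sub>2"
  using \<alpha>_closed carrier2 by simp

lemma \<alpha>_hom: "group_hom ((add_monoid B\<^sub>1)\<lparr>carrier := I\<^sub>1\<rparr>) ((add_monoid B\<^sub>2)\<lparr>carrier := I\<^sub>2\<rparr>) \<alpha>"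
  using iso subgroup.subgroup_is_group[OF sub1 B1.add_group]
    subgroup.subgroup_is_group[OF sub2 B2.add_group]
  by (simp add: group_hom_def group_hom_axioms_def brace_iso_def iso_def)

lemma \<alpha>_add: "\<lbrakk>i \<in> I\<^sub>1; j \<in> I\<^sub>1\<rbrakk> \<Longrightarrow> \<alpha> (i \<oplus>\<^bsub>B\<^sub>1\<^esub> j) = \<alpha> i \<oplus>\<^bsub>B\<^sub>2\<^esub> \<alpha> j"
  using group_hom.hom_mult[OF \<alpha>_hom] by simp

lemma \<alpha>_zero: "\<alpha> \<zero>\<^bsub>B\<^sub>1\<^esub> = \<zero>\<^bsub>B\<^sub>2\<^esub>"
  using group_hom.hom_one[OF \<alpha>_hom] by simp

text \<open>Inverses in a record with restricted carrier are formally not the ambient ones, so the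
  value is found from \<alpha>(-i) + \<alpha>(i) = \<alpha>(0) = 0 and uniqueness of inverses in
  B_2.\<close>

lemma \<alpha>_a_inv:
  assumes i: "i \<in> I\<^sub>1"
  shows "\<alpha> (\<ominus>\<^bsub>B\<^sub>1\<^esub> i) = \<ominus>\<^bsub>B\<^sub>2\<^esub> \<alpha> i"
proof -
  have "\<ominus>\<^bsub>B\<^sub>1\<^esub> i \<in> I\<^sub>1"
    using B1.add.subgroupE(3)[OF sub1 i] .
  then have "\<alpha> (\<ominus>\<^bsub>B\<^sub>1\<^esub> i) \<oplus>\<^bsub>B\<^sub>2\<^esub> \<alpha> i = \<zero>\<^bsub>B\<^sub>2\<^esub>" "\<alpha> (\<ominus>\<^bsub>B\<^sub>1\<^esub> i) \<in> carrier B\<^sub>2"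
    using \<alpha>_add[of "\<ominus>\<^bsub>B\<^sub>1\<^esub> i" i] i carrier1[OF i] \<alpha>_zero \<alpha>_carrier by simp_all
  then show ?thesis
    using B2.add.inv_equality \<alpha>_carrier[OF i] by metis
qed

lemma mem_amalg_iff: "(a, b) \<in> N \<longleftrightarrow> a \<in> I\<^sub>1 \<and> b = \<ominus>\<^bsub>B\<^sub>2\<^esub> \<alpha> a"
  by (auto simp: amalg_def)

text \<open>For central sets the multiplicative and \<lambda> conditions are automatic by
  \<open>D.central_ideal_iff_subgroup\<close>, leaving an additive subgroup check and
  centrality.\<close>

lemma amalg_central: "central_ideal N D"
  unfolding D.central_ideal_iff_subgroup
proof
  note [simp] = mem_amalg_iff carrier1 \<alpha>_carrier
  have closed: "i \<oplus>\<^bsub>B\<^sub>1\<^esub> j \<in> I\<^sub>1" "\<ominus>\<^bsub>B\<^sub>1\<^esub> i \<in> I\<^sub>1" if "i \<in> I\<^sub>1" "j \<in> I\<^sub>1" for i j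
    using B1.add.subgroupE(3,4)[OF sub1] that by auto
  show "subgroup N (add_monoid D)"
  proof (rule D.add.subgroupI)
    show "N \<subseteq> carrier D" by auto
    show "N \<noteq> {}" using subgroup.one_closed[OF sub1] by (auto simp: amalg_def)
    show "\<ominus>\<^bsub>D\<^esub> x \<in> N" if "x \<in> N" for x
      using that by (cases x) (auto simp: closed \<alpha>_a_inv)
    show "x \<oplus>\<^bsub>D\<^esub> y \<in> N" if xy: "x \<in> N" "y \<in> N" for x y
    proof -
      obtain i where i: "i \<in> I\<^sub>1" "x = (i, \<ominus>\<^bsub>B\<^sub>2\<^esub> \<alpha> i)"
        using xy(1) unfolding amalg_def by blast
      obtain j where j: "j \<in> I\<^sub>1" "y = (j, \<ominus>\<^bsub>B\<^sub>2\<^esub> \<alpha> j)"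
        using xy(2) unfolding amalg_def by blast
      \<comment> \<open>The second coordinates add up to -\<alpha>(i) - \<alpha>(j) = -(\<alpha>(j)
        + \<alpha>(i)); centrality of \<alpha>(i) repairs the reversed order.\<close>
      have "\<alpha> (i \<oplus>\<^bsub>B\<^sub>1\<^esub> j) = \<alpha> j \<oplus>\<^bsub>B\<^sub>2\<^esub> \<alpha> i"
        using B2.brace_centerD(2)[of "\<alpha> i" "\<alpha> j"] \<alpha>_closed center2 i j by (auto simp: \<alpha>_add)
      then show ?thesis
        using i j closed by (simp add: B2.add.inv_mult_group)
    qed
  qed
  show "N \<subseteq> brace_center D"
  proof (rule subset_trans[OF _ brace_center_RDirProd])
    show "N \<subseteq> brace_center B\<^sub>1 \<times> brace_center B\<^sub>2"
      using center1 center2 \<alpha>_closed B2.add.subgroupE(3)[OF sub2] by (auto simp: amalg_def)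
  qed
qed

sublocale \<pi>: skew_brace_epi D P \<pi>
  unfolding external_central_product_def by (rule D.quotient_epi[OF amalg_central])

lemma left_factor_eq: "left_factor B\<^sub>1 B\<^sub>2 I\<^sub>1 \<alpha> = \<pi> ` (carrier B\<^sub>1 \<times> {\<zero>\<^bsub>B\<^sub>2\<^esub>})"
  unfolding left_factor_def by (rule D.image_mod_central[OF amalg_central]) auto

lemma right_factor_eq: "right_factor B\<^sub>1 B\<^sub>2 I\<^sub>1 \<alpha> = \<pi> ` ({\<zero>\<^bsub>B\<^sub>1\<^esub>} \<times> carrier B\<^sub>2)"
  unfolding right_factor_def by (rule D.image_mod_central[OF amalg_central]) auto

text \<open>The difference of the two pairs must lie in \<open>N\<close>. This criterion yields both
  the intersection of the factors and the injectivity of \<open>\<pi>\<close> on I_1 x 0.\<close>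

lemma \<pi>_eq_iff:
  assumes "a \<in> carrier B\<^sub>1" "b \<in> carrier B\<^sub>2" "c \<in> carrier B\<^sub>1" "d \<in> carrier B\<^sub>2"
  shows "\<pi> (a, b) = \<pi> (c, d) \<longleftrightarrow>
    a \<oplus>\<^bsub>B\<^sub>1\<^esub> \<ominus>\<^bsub>B\<^sub>1\<^esub> c \<in> I\<^sub>1 \<and> b \<oplus>\<^bsub>B\<^sub>2\<^esub> \<ominus>\<^bsub>B\<^sub>2\<^esub> d = \<ominus>\<^bsub>B\<^sub>2\<^esub> \<alpha> (a \<oplus>\<^bsub>B\<^sub>1\<^esub> \<ominus>\<^bsub>B\<^sub>1\<^esub> c)"
proof -
  have "subgroup N (add_monoid D)"
    using amalg_central by (simp add: D.central_ideal_iff_subgroup)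
  from D.rcos_eq_iff[OF this, of "(a, b)" "(c, d)"] show ?thesis
    using assms by (simp add: mem_amalg_iff)
qed

section \<open>The two factors, their intersection and their central product\<close>

lemma factors_Int: "left_factor B\<^sub>1 B\<^sub>2 I\<^sub>1 \<alpha> \<inter> right_factor B\<^sub>1 B\<^sub>2 I\<^sub>1 \<alpha> = \<pi> ` (I\<^sub>1 \<times> {\<zero>\<^bsub>B\<^sub>2\<^esub>})"
proof (intro equalityI subsetI)
  fix x assume "x \<in> left_factor B\<^sub>1 B\<^sub>2 I\<^sub>1 \<alpha> \<inter> right_factor B\<^sub>1 B\<^sub>2 I\<^sub>1 \<alpha>"
  then obtain a b where a: "a \<in> carrier B\<^sub>1" "x = \<pi> (a, \<zero>\<^bsub>B\<^sub>2\<^esub>)"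
    and b: "b \<in> carrier B\<^sub>2" "x = \<pi> (\<zero>\<^bsub>B\<^sub>1\<^esub>, b)"
    by (auto simp: left_factor_eq right_factor_eq)
  then show "x \<in> \<pi> ` (I\<^sub>1 \<times> {\<zero>\<^bsub>B\<^sub>2\<^esub>})"
    using \<pi>_eq_iff[of a "\<zero>\<^bsub>B\<^sub>2\<^esub>" "\<zero>\<^bsub>B\<^sub>1\<^esub>" b] by auto
next
  fix x assume "x \<in> \<pi> ` (I\<^sub>1 \<times> {\<zero>\<^bsub>B\<^sub>2\<^esub>})"
  then obtain i where i: "i \<in> I\<^sub>1" "x = \<pi> (i, \<zero>\<^bsub>B\<^sub>2\<^esub>)" by auto
  \<comment> \<open>The pairs (i, 0) and (0, \<alpha>(i)) differ by (i, -\<alpha>(i)) in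
    \<open>N\<close>, which exhibits x in the right factor too.\<close>
  then have "x = \<pi> (\<zero>\<^bsub>B\<^sub>1\<^esub>, \<alpha> i)"
    using \<pi>_eq_iff[of i "\<zero>\<^bsub>B\<^sub>2\<^esub>" "\<zero>\<^bsub>B\<^sub>1\<^esub>" "\<alpha> i"] carrier1 \<alpha>_carrier by simp
  then show "x \<in> left_factor B\<^sub>1 B\<^sub>2 I\<^sub>1 \<alpha> \<inter> right_factor B\<^sub>1 B\<^sub>2 I\<^sub>1 \<alpha>"
    using i carrier1 \<alpha>_carrier by (auto simp: left_factor_eq right_factor_eq)
qed

lemma internal_central_product_factors:
  "internal_central_product P (left_factor B\<^sub>1 B\<^sub>2 I\<^sub>1 \<alpha>) (right_factor B\<^sub>1 B\<^sub>2 I\<^sub>1 \<alpha>)"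
proof -
  let ?l = "\<lambda>a. (a, \<zero>\<^bsub>B\<^sub>2\<^esub>)" and ?r = "\<lambda>b. (\<zero>\<^bsub>B\<^sub>1\<^esub>, b)"
  \<comment> \<open>Splitting (a, b) = (a, 0) + (0, b) makes the whole quotient the sum of the two
    images.\<close>
  have decomp: "\<pi> (a, b) = \<pi> (?l a) \<oplus>\<^bsub>P\<^esub> \<pi> (?r b)"
    if "a \<in> carrier B\<^sub>1" "b \<in> carrier B\<^sub>2" for a b
    using that \<pi>.h_add[of "?l a" "?r b"] by simp
  have "carrier P = (\<Union>a\<in>carrier B\<^sub>1. \<Union>b\<in>carrier B\<^sub>2. {\<pi> (a, b)})"
    unfolding \<pi>.surj[symmetric] by auto
  also have "\<dots> = (\<Union>a\<in>carrier B\<^sub>1. \<Union>b\<in>carrier B\<^sub>2. {\<pi> (?l a) \<oplus>\<^bsub>P\<^esub> \<pi> (?r b)})"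
    by (intro SUP_cong refl arg_cong[where f = "\<lambda>x. {x}"] decomp)
  also have "\<dots> = \<pi> ` (carrier B\<^sub>1 \<times> {\<zero>\<^bsub>B\<^sub>2\<^esub>}) <+>\<^bsub>P\<^esub> \<pi> ` ({\<zero>\<^bsub>B\<^sub>1\<^esub>} \<times> carrier B\<^sub>2)"
    by (auto simp: set_add_def')
  finally have sum: "carrier P = \<dots>" .
  have comm: "\<ominus>\<^bsub>P\<^esub> \<pi> (?l a) \<ominus>\<^bsub>P\<^esub> \<pi> (?r b) \<oplus>\<^bsub>P\<^esub> \<pi> (?l a) \<oplus>\<^bsub>P\<^esub> \<pi> (?r b) = \<zero>\<^bsub>P\<^esub>"
    and star: "brace_star P (\<pi> (?l a)) (\<pi> (?r b)) = \<zero>\<^bsub>P\<^esub>"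
    "brace_star P (\<pi> (?r b)) (\<pi> (?l a)) = \<zero>\<^bsub>P\<^esub>"
    if ab: "a \<in> carrier B\<^sub>1" "b \<in> carrier B\<^sub>2" for a b
  proof -
    \<comment> \<open>In each coordinate one of the two arguments is zero, so the commutator and
      both star products cancel before passing to the quotient.\<close>
    have D: "?l a \<in> carrier D" "?r b \<in> carrier D"
      "\<ominus>\<^bsub>D\<^esub> ?l a \<ominus>\<^bsub>D\<^esub> ?r b \<oplus>\<^bsub>D\<^esub> ?l a \<oplus>\<^bsub>D\<^esub> ?r b = \<zero>\<^bsub>D\<^esub>"
      "brace_star D (?l a) (?r b) = \<zero>\<^bsub>D\<^esub>" "brace_star D (?r b) (?l a) = \<zero>\<^bsub>D\<^esub>"
      using ab by (simp_all add: a_minus_def brace_star_def)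
    show "\<ominus>\<^bsub>P\<^esub> \<pi> (?l a) \<ominus>\<^bsub>P\<^esub> \<pi> (?r b) \<oplus>\<^bsub>P\<^esub> \<pi> (?l a) \<oplus>\<^bsub>P\<^esub> \<pi> (?r b) = \<zero>\<^bsub>P\<^esub>"
      using \<pi>.h_commutator[OF D(1,2)] unfolding D(3) \<pi>.h_zero by simp
    show "brace_star P (\<pi> (?l a)) (\<pi> (?r b)) = \<zero>\<^bsub>P\<^esub>"
      using \<pi>.h_star[OF D(1,2)] unfolding D(4) \<pi>.h_zero by simp
    show "brace_star P (\<pi> (?r b)) (\<pi> (?l a)) = \<zero>\<^bsub>P\<^esub>"
      using \<pi>.h_star[OF D(2,1)] unfolding D(5) \<pi>.h_zero by simp
  qed
  have "\<pi> ` (I\<^sub>1 \<times> {\<zero>\<^bsub>B\<^sub>2\<^esub>}) \<subseteq> brace_center P"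
  proof -
    have "I\<^sub>1 \<times> {\<zero>\<^bsub>B\<^sub>2\<^esub>} \<subseteq> brace_center D"
      using brace_center_RDirProd center1 center2 subgroup.one_closed[OF sub2] by auto
    then show ?thesis
      using \<pi>.image_center by blast
  qed
  moreover have
    "brace_star_set P (\<pi> ` (carrier B\<^sub>1 \<times> {\<zero>\<^bsub>B\<^sub>2\<^esub>})) (\<pi> ` ({\<zero>\<^bsub>B\<^sub>1\<^esub>} \<times> carrier B\<^sub>2)) = {\<zero>\<^bsub>P\<^esub>}"
    "brace_star_set P (\<pi> ` ({\<zero>\<^bsub>B\<^sub>1\<^esub>} \<times> carrier B\<^sub>2)) (\<pi> ` (carrier B\<^sub>1 \<times> {\<zero>\<^bsub>B\<^sub>2\<^esub>})) = {\<zero>\<^bsub>P\<^esub>}"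
    using star by (auto intro!: \<pi>.C.brace_star_set_trivial)
  moreover have "\<forall>i\<in>\<pi> ` (carrier B\<^sub>1 \<times> {\<zero>\<^bsub>B\<^sub>2\<^esub>}). \<forall>j\<in>\<pi> ` ({\<zero>\<^bsub>B\<^sub>1\<^esub>} \<times> carrier B\<^sub>2).
      \<ominus>\<^bsub>P\<^esub> i \<ominus>\<^bsub>P\<^esub> j \<oplus>\<^bsub>P\<^esub> i \<oplus>\<^bsub>P\<^esub> j = \<zero>\<^bsub>P\<^esub>"
    using comm by auto
  \<comment> \<open>The intersection is rewritten by \<open>factors_Int\<close> first, while the
    factors still occur under their names; afterwards they are replaced by images.\<close>
  ultimately show ?thesis
    unfolding internal_central_product_def factors_Int unfolding left_factor_eq right_factor_eq
    using \<pi>.image_is_skew_brace \<pi>.image_ideal[OF left_ideal] \<pi>.image_ideal[OF right_ideal] sum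
    by blast
qed

text \<open>The map i \<mapsto> \<open>\<pi> (i, 0)\<close> goes from I_1 onto the intersection.
  Building this direction and inverting it avoids choosing representatives of classes.\<close>

lemma factors_Int_isomorphic:
  "sub_brace P (left_factor B\<^sub>1 B\<^sub>2 I\<^sub>1 \<alpha> \<inter> right_factor B\<^sub>1 B\<^sub>2 I\<^sub>1 \<alpha>) \<simeq>\<^sub>b sub_brace B\<^sub>1 I\<^sub>1"
proof (rule brace_isomorphic_sym)
  show "group (add_monoid (sub_brace B\<^sub>1 I\<^sub>1))"
    using subgroup.subgroup_is_group[OF sub1 B1.add_group] by simp
  have "subgroup I\<^sub>1 B\<^sub>1"
    using central1 by (simp add: central_ideal_def brace_ideal_def normal_imp_subgroup)
  then show "group (sub_brace B\<^sub>1 I\<^sub>1)"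
    using subgroup.subgroup_is_group B1.mult_group by blast
  have "inj_on (\<lambda>i. \<pi> (i, \<zero>\<^bsub>B\<^sub>2\<^esub>)) I\<^sub>1"
  proof (rule inj_onI)
    fix i j assume ij: "i \<in> I\<^sub>1" "j \<in> I\<^sub>1" and eq: "\<pi> (i, \<zero>\<^bsub>B\<^sub>2\<^esub>) = \<pi> (j, \<zero>\<^bsub>B\<^sub>2\<^esub>)"
    let ?k = "i \<oplus>\<^bsub>B\<^sub>1\<^esub> \<ominus>\<^bsub>B\<^sub>1\<^esub> j"
    \<comment> \<open>Equal classes put (i - j, 0) into \<open>N\<close>, so \<alpha>(i - j) = 0 =
      \<alpha>(0), and injectivity of \<alpha> gives i = j.\<close>
    have k: "?k \<in> I\<^sub>1" "\<zero>\<^bsub>B\<^sub>2\<^esub> = \<ominus>\<^bsub>B\<^sub>2\<^esub> \<alpha> ?k"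
      using eq ij carrier1 \<pi>_eq_iff[of i "\<zero>\<^bsub>B\<^sub>2\<^esub>" j "\<zero>\<^bsub>B\<^sub>2\<^esub>"] by auto
    then have "\<alpha> ?k = \<alpha> \<zero>\<^bsub>B\<^sub>1\<^esub>"
      using B2.add.inv_eq_1_iff[OF \<alpha>_carrier[OF k(1)]] \<alpha>_zero by simp
    then have "?k = \<zero>\<^bsub>B\<^sub>1\<^esub>"
      using bij k(1) subgroup.one_closed[OF sub1] by (auto simp: bij_betw_def dest: inj_onD)
    then show "i = j"
      using ij carrier1 by (metis B1.add.inv_closed B1.add.inv_equality B1.add.inv_inv)
  qed
  moreover have "(\<lambda>i. \<pi> (i, \<zero>\<^bsub>B\<^sub>2\<^esub>)) ` I\<^sub>1 = \<pi> ` (I\<^sub>1 \<times> {\<zero>\<^bsub>B\<^sub>2\<^esub>})"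
    by auto
  ultimately have "(\<lambda>i. \<pi> (i, \<zero>\<^bsub>B\<^sub>2\<^esub>)) \<in> brace_iso (sub_brace B\<^sub>1 I\<^sub>1) (sub_brace P (\<pi> ` (I\<^sub>1 \<times> {\<zero>\<^bsub>B\<^sub>2\<^esub>})))"
    by (intro brace_isoI) (auto simp: bij_betw_def carrier1 simp flip: \<pi>.h_add \<pi>.h_mult)
  then show "sub_brace B\<^sub>1 I\<^sub>1 \<simeq>\<^sub>b sub_brace P (left_factor B\<^sub>1 B\<^sub>2 I\<^sub>1 \<alpha> \<inter> right_factor B\<^sub>1 B\<^sub>2 I\<^sub>1 \<alpha>)"
    unfolding factors_Int brace_isomorphic_def by auto
qed

end

theorem proposition1:
  fixes B\<^sub>1 :: "('a, 'm) ring_scheme" and B\<^sub>2 :: "('b, 'n) ring_scheme"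
    and I\<^sub>1 :: "'a set" and I\<^sub>2 :: "'b set" and \<alpha> :: "'a \<Rightarrow> 'b"
  assumes "skew_brace B\<^sub>1" and "finite (carrier B\<^sub>1)"
    and "skew_brace B\<^sub>2" and "finite (carrier B\<^sub>2)"
    and "central_ideal I\<^sub>1 B\<^sub>1" and "central_ideal I\<^sub>2 B\<^sub>2"
    and "\<alpha> \<in> brace_iso (sub_brace B\<^sub>1 I\<^sub>1) (sub_brace B\<^sub>2 I\<^sub>2)"
  shows "let P = external_central_product B\<^sub>1 B\<^sub>2 I\<^sub>1 \<alpha>;
             L = left_factor B\<^sub>1 B\<^sub>2 I\<^sub>1 \<alpha>;
             R = right_factor B\<^sub>1 B\<^sub>2 I\<^sub>1 \<alpha>
         in internal_central_product P L R
            \<and> sub_brace P (L \<inter> R) \<simeq>\<^sub>b sub_brace B\<^sub>1 I\<^sub>1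
            \<and> sub_brace B\<^sub>1 I\<^sub>1 \<simeq>\<^sub>b sub_brace B\<^sub>2 I\<^sub>2"
proof -
  interpret central_amalgam B\<^sub>1 B\<^sub>2 I\<^sub>1 I\<^sub>2 \<alpha>
    using assms by (simp add: central_amalgam_def central_amalgam_axioms_def skew_brace_pair_def)
  \<comment> \<open>The isomorphism between I_1 and I_2 is witnessed by \<alpha> itself.\<close>
  show ?thesis
    unfolding Let_def
    using internal_central_product_factors factors_Int_isomorphic iso brace_isomorphic_def by blast
qed

end
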